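(* Let $g_1,g_2\in\mathbb{R}[X_1,\dots,X_n]$. Suppose $g_1$ and $g_2$ have no common zero on $\{0,1\}^n$, and $g_1(x)g_2(x)=0$ for all $x\in\{0,1\}^n$. Then there exist $h_1,h_2\in\mathbb{R}[X_1,\dots,X_n]$ such that $h_1(x)g_1(x)+h_2(x)g_2(x)=1$ for all $x\in\{0,1\}^n$, and \[ \max\big(\deg(\overline{h_1g_1}),\deg(\overline{h_2g_2})\big)\le 2\deg(g_1)^2\deg(g_2)^2, \] where for a polynomial $r$, $\overline{r}$ denotes its multilinearization obtained by applying the relations $X_1^2=X_1,\dots,X_n^2=X_n$. *)

theory Defs
  imports Complex_Main "HOL-Library.Poly_Mapping" "HOL-Library.FuncSet"
begin

text \<open>
  A monomial is a finitely supported exponent vector, a real polynomial a finitely supported map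
  from monomials to coefficients; ring operations on polynomials are the convolution operations
  of \<^theory>\<open>HOL-Library.Poly_Mapping\<close>. The variables \<open>X\<^sub>1, \<dots>, X\<^sub>n\<close> are indexed by
  \<open>{..<n}\<close>.
\<close>

type_synonym monomial = "nat \<Rightarrow>\<^sub>0 nat"
type_synonym real_mpoly = "monomial \<Rightarrow>\<^sub>0 real"

definition mpolys :: "nat \<Rightarrow> real_mpoly set" where
  "mpolys n = {p. \<forall>m \<in> Poly_Mapping.keys p. Poly_Mapping.keys m \<subseteq> {..<n}}"

definition eval_monomial :: "(nat \<Rightarrow> real) \<Rightarrow> monomial \<Rightarrow> real" where
  "eval_monomial x m = (\<Prod>i \<in> Poly_Mapping.keys m. x i ^ Poly_Mapping.lookup m i)"

definition eval_mpoly :: "(nat \<Rightarrow> real) \<Rightarrow> real_mpoly \<Rightarrow> real" where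
  "eval_mpoly x p =
     (\<Sum>m \<in> Poly_Mapping.keys p. Poly_Mapping.lookup p m * eval_monomial x m)"

definition monomial_degree :: "monomial \<Rightarrow> nat" where
  "monomial_degree m = (\<Sum>i \<in> Poly_Mapping.keys m. Poly_Mapping.lookup m i)"

text \<open>Total degree, with the convention that the zero polynomial has degree 0.\<close>

definition mpoly_degree :: "real_mpoly \<Rightarrow> nat" where
  "mpoly_degree p = Max (insert 0 (monomial_degree ` Poly_Mapping.keys p))"

text \<open>
  Rewriting with \<open>X\<^sub>i\<^sup>2 = X\<^sub>i\<close> replaces every positive exponent by 1. Distinct
  monomials may become equal, in which case their coefficients are added up.
\<close>

definition multilinear_monomial :: "monomial \<Rightarrow> monomial" where
  "multilinear_monomial m = (\<Sum>i \<in> Poly_Mapping.keys m. Poly_Mapping.single i 1)"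

definition multilinearization :: "real_mpoly \<Rightarrow> real_mpoly" where
  "multilinearization p =
     (\<Sum>m \<in> Poly_Mapping.keys p.
        Poly_Mapping.single (multilinear_monomial m) (Poly_Mapping.lookup p m))"

definition cube :: "nat \<Rightarrow> (nat \<Rightarrow> real) set" where
  "cube n = ({..<n} \<rightarrow>\<^sub>E {0, 1})"

end

theory Submission
  imports Defs "HOL-Computational_Algebra.Polynomial"
begin

text \<open>
  Taking \<open>h\<^sub>i = 1 / g\<^sub>i\<close> on the support of \<open>g\<^sub>i\<close> and \<open>0\<close> elsewhere, \<open>h\<^sub>1 g\<^sub>1\<close> is the Boolean
  function \<open>f = [g\<^sub>1 \<noteq> 0]\<close> and \<open>h\<^sub>2 g\<^sub>2 = 1 - f\<close>, so the point is to bound the degree of \<open>f\<close>.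

  Let \<open>x\<close> maximise \<open>\<bar>g\<^sub>2\<bar>\<close> on the cube, normalised to \<open>g\<^sub>2(x) = 1\<close>. Every top-degree monomial \<open>M\<close>
  of \<open>g\<^sub>1\<close> allows \<open>x\<close> to be changed inside \<open>M\<close> so that \<open>g\<^sub>1\<close> becomes nonzero and hence
  \<open>g\<^sub>2\<close> becomes zero. Given \<open>k\<close> disjoint such monomials, make each of these changes independently
  with probability \<open>t\<close>: the expectation of \<open>g\<^sub>2\<close> is a polynomial in \<open>t\<close> of degree at most
  \<open>deg g\<^sub>2\<close>, bounded by 1 on \<open>[0,1]\<close>, with derivative \<open>-k\<close> at 0. Markov's inequality at the endpoint
  gives \<open>k \<le> 2 (deg g\<^sub>2)\<^sup>2\<close>. Fixing all variables of a maximal disjoint family of top-degree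
  monomials of \<open>g\<^sub>1\<close> lowers its degree, and induction on \<open>deg g\<^sub>1\<close> bounds the degree of \<open>f\<close>.
\<close>

section \<open>Markov's inequality at an endpoint\<close>

fun chebyshev :: "nat \<Rightarrow> real poly" where
  "chebyshev 0 = 1"
| "chebyshev (Suc 0) = [:0, 1:]"
| "chebyshev (Suc (Suc n)) = [:0, 2:] * chebyshev (Suc n) - chebyshev n"

lemma degree_chebyshev_le: "degree (chebyshev n) \<le> n"
proof (induction n rule: chebyshev.induct)
  case (3 n)
  have "degree ([:0, 2:] * chebyshev (Suc n)) \<le> Suc (Suc n)"
    using degree_mult_le[of "[:0, 2:]" "chebyshev (Suc n)"] 3 by simp
  then show ?case using 3 by (auto intro!: degree_diff_le)
qed auto

lemma poly_chebyshev_cos: "poly (chebyshev n) (cos t) = cos (real n * t)"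
proof (induction n rule: chebyshev.induct)
  case (3 n)
  have "cos (real (Suc (Suc n)) * t) + cos (real n * t) = 2 * cos t * cos (real (Suc n) * t)"
    using cos_plus_cos[of "real (Suc (Suc n)) * t" "real n * t"]
    by (simp add: algebra_simps add_divide_distrib)
  with 3 show ?case by (simp add: algebra_simps)
qed auto

text \<open>Differentiating the recurrence at 1, where every Chebyshev polynomial has value 1, gives
  2 + 2(n+1)^2 - n^2 = (n+2)^2.\<close>

lemma poly_pderiv_chebyshev_one: "poly (pderiv (chebyshev n)) 1 = (real n)\<^sup>2"
proof (induction n rule: chebyshev.induct)
  case (3 n)
  have "poly (chebyshev k) 1 = 1" for k
    using poly_chebyshev_cos[of k 0] by simp
  with 3 show ?case
    by (simp add: pderiv_diff pderiv_mult pderiv_smult pderiv_pCons power2_eq_square algebra_simps)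
qed (auto simp: pderiv_pCons)

text \<open>Rolle yields d - 1 distinct zeros of the derivative, one in each gap between consecutive
  \<open>x i\<close>. All of them lie below \<open>a\<close>, so \<open>a\<close> is one more, and a
  nonzero polynomial has at most as many roots as its degree.\<close>

lemma rolle_le_degree_pderiv:
  fixes p :: "real poly" and x :: "nat \<Rightarrow> real"
  assumes "\<And>i j. i < j \<Longrightarrow> j < d \<Longrightarrow> x i > x j"
    and "\<And>i. i < d \<Longrightarrow> poly p (x i) = 0" and "\<And>i. i < d \<Longrightarrow> x i < a"
    and "poly (pderiv p) a = 0" and "pderiv p \<noteq> 0" and "d > 0"
  shows "d \<le> degree (pderiv p)"
proof -
  have "\<exists>z. x (Suc i) < z \<and> z < x i \<and> poly (pderiv p) z = 0" if "Suc i < d" for i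
  proof -
    have lt: "x (Suc i) < x i" using assms(1) that by simp
    then obtain z where "x (Suc i) < z" "z < x i"
      "poly p (x i) - poly p (x (Suc i)) = (x i - x (Suc i)) * poly (pderiv p) z"
      using poly_MVT by blast
    then show ?thesis using assms(2) that lt by (intro exI[of _ z]) auto
  qed
  then have "\<forall>i. \<exists>z. Suc i < d \<longrightarrow> x (Suc i) < z \<and> z < x i \<and> poly (pderiv p) z = 0"
    by blast
  from choice[OF this] obtain z
    where z: "\<And>i. Suc i < d \<Longrightarrow> x (Suc i) < z i \<and> z i < x i \<and> poly (pderiv p) (z i) = 0"
    by blast
  have z_mono: "z i > z j" if "i < j" "Suc j < d" for i j
  proof -
    have "x j \<le> x (Suc i)"
      using assms(1)[of "Suc i" j] that by (cases "Suc i = j") auto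
    then show ?thesis using z[of i] z[of j] that by auto
  qed
  have inj: "inj_on z {..<d - 1}"
  proof (rule linorder_inj_onI)
    fix i j assume "i < j" "i \<in> {..<d - 1}" "j \<in> {..<d - 1}"
    then have "Suc j < d" by auto
    then show "z i \<noteq> z j" using z_mono[of i j] \<open>i < j\<close> by auto
  qed auto
  have "a \<notin> z ` {..<d - 1}"
  proof
    assume "a \<in> z ` {..<d - 1}"
    then obtain i where "i < d - 1" and i: "a = z i" by auto
    then have "Suc i < d" by simp
    with i show False using z[of i] assms(3)[of i] by auto
  qed
  then have "card (insert a (z ` {..<d - 1})) = d"
    using inj \<open>d > 0\<close> by (simp add: card_image)
  moreover have "insert a (z ` {..<d - 1}) \<subseteq> {y. poly (pderiv p) y = 0}"
    using z assms(4) by auto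
  ultimately have "d \<le> card {y. poly (pderiv p) y = 0}"
    using card_mono[OF poly_roots_finite[OF assms(5)]] by metis
  then show ?thesis
    using card_poly_roots_bound[OF assms(5)] by linarith
qed

lemma alternating_imp_zeros:
  fixes p :: "real poly" and y :: "nat \<Rightarrow> real"
  assumes dec: "\<And>i. i < d \<Longrightarrow> y (Suc i) < y i"
    and alt: "\<And>i. i \<le> d \<Longrightarrow> (-1) ^ i * poly p (y i) > 0"
  obtains x where "\<And>i. i < d \<Longrightarrow> y (Suc i) < x i \<and> x i < y i \<and> poly p (x i) = 0"
proof -
  have "\<exists>x. y (Suc i) < x \<and> x < y i \<and> poly p x = 0" if "i < d" for i
  proof -
    have "poly p (y (Suc i)) * poly p (y i) < 0"
      using alt[of i] alt[of "Suc i"] that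
      by (cases "even i") (auto simp: mult_less_0_iff)
    then show ?thesis using poly_IVT[OF dec[OF that]] by auto
  qed
  then have "\<forall>i. \<exists>x. i < d \<longrightarrow> y (Suc i) < x \<and> x < y i \<and> poly p x = 0" by blast
  from choice[OF this] show ?thesis using that by blast
qed

text \<open>Comparison with the Chebyshev polynomial, whose derivative at 1 is d^2. If
  \<open>p\<close> were steeper there, the difference \<open>r\<close> of the Chebyshev polynomial
  and a multiple of \<open>p\<close> would have d zeros below 1 and a critical point at 1. By Rolle
  its derivative would have d roots, although its degree is below d.\<close>

lemma markov_at_one:
  fixes p :: "real poly"
  assumes deg: "degree p \<le> d" and bound: "\<And>s. -1 \<le> s \<Longrightarrow> s \<le> 1 \<Longrightarrow> \<bar>poly p s\<bar> \<le> 1"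
  shows "poly (pderiv p) 1 \<le> (real d)\<^sup>2"
proof (cases "d = 0")
  case True
  then show ?thesis using deg by (auto elim!: degree_eq_zeroE simp: pderiv_pCons)
next
  case False
  show ?thesis
  proof (rule ccontr)
    assume "\<not> ?thesis"
    then have big: "poly (pderiv p) 1 > (real d)\<^sup>2" by simp
    then have pos: "poly (pderiv p) 1 > 0"
      by (meson le_less_trans zero_le_power2)
    (* The scaling makes the derivative of r vanish at 1, while l < 1 keeps r alternating
       at the extrema of the Chebyshev polynomial. *)
    define l where "l = (real d)\<^sup>2 / poly (pderiv p) 1"
    have l: "0 < l" "l < 1" "l * poly (pderiv p) 1 = (real d)\<^sup>2"
      using big pos False by (auto simp: l_def)
    define r where "r = chebyshev d - smult l p"
    \<comment> \<open>These are the extrema of the Chebyshev polynomial on [-1,1], listed from right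
      to left, where it takes the values 1, -1, 1, and so on. The division by \<open>d\<close> is
      why \<open>d = 0\<close> is a separate case.\<close>
    define y where "y i = cos (real i * pi / real d)" for i :: nat
    have dec: "y j < y i" if "i < j" "j \<le> d" for i j
      unfolding y_def using that False
      by (intro cos_monotone_0_pi) (auto simp: field_simps)
    have alt: "(-1) ^ i * poly r (y i) > 0" if "i \<le> d" for i
    proof -
      have "poly (chebyshev d) (y i) = (-1) ^ i"
        using False by (simp add: y_def poly_chebyshev_cos)
      moreover have "\<bar>l * poly p (y i)\<bar> < 1"
      proof -
        have "l * \<bar>poly p (y i)\<bar> \<le> l * 1"
          using bound[of "y i"] l by (intro mult_left_mono) (auto simp: y_def)
        moreover have "\<bar>l * poly p (y i)\<bar> = l * \<bar>poly p (y i)\<bar>" using l by (simp add: abs_mult)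
        ultimately show ?thesis using l by linarith
      qed
      ultimately show ?thesis
        by (cases "even i") (auto simp: r_def algebra_simps abs_if split: if_splits)
    qed
    obtain x where x: "\<And>i. i < d \<Longrightarrow> y (Suc i) < x i \<and> x i < y i \<and> poly r (x i) = 0"
      using alternating_imp_zeros[of d y r] dec alt by (auto simp: Suc_le_eq)
    have x_dec: "x i > x j" if "i < j" "j < d" for i j
    proof -
      have "y j \<le> y (Suc i)"
        using dec[of "Suc i" j] that by (cases "Suc i = j") auto
      then show ?thesis using x[of i] x[of j] that by auto
    qed
    have x_less: "x i < 1" if "i < d" for i
      using x[OF that] cos_le_one[of "real i * pi / real d"] unfolding y_def by linarith
    have deg_r: "degree r \<le> d"
      unfolding r_def using deg degree_chebyshev_le
      by (intro degree_diff_le) (auto intro: order.trans[OF degree_smult_le])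
    \<comment> \<open>Otherwise \<open>r\<close> is constant, contradicting its opposite signs at
      \<open>y 0\<close> and \<open>y 1\<close>.\<close>
    have "pderiv r \<noteq> 0"
    proof
      assume "pderiv r = 0"
      then have "poly r u = poly r v" for u v
        by (auto simp: pderiv_eq_0_iff elim!: degree_eq_zeroE)
      then have "poly r (y 0) = poly r (y 1)" by blast
      then show False using alt[of 0] alt[of 1] False by auto
    qed
    moreover have "poly (pderiv r) 1 = 0"
      using l by (simp add: r_def pderiv_diff pderiv_smult poly_pderiv_chebyshev_one)
    ultimately have "d \<le> degree (pderiv r)"
      using rolle_le_degree_pderiv[of d x r 1] x x_dec x_less False by auto
    then show False using deg_r False by (simp add: degree_pderiv)
  qed
qed

text \<open>The substitution t = (1 - s)/2 maps [-1,1] onto [0,1] and sends 1 to 0. It multiplies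
  the derivative by -1/2, which accounts for the sign and the factor 2.\<close>

lemma markov_at_zero:
  fixes p :: "real poly"
  assumes deg: "degree p \<le> d" and bound: "\<And>t. 0 \<le> t \<Longrightarrow> t \<le> 1 \<Longrightarrow> \<bar>poly p t\<bar> \<le> 1"
  shows "- coeff p 1 \<le> 2 * (real d)\<^sup>2"
proof -
  define q where "q = pcompose p [:1/2, -1/2:]"
  have "degree q \<le> d"
    using deg by (simp add: q_def degree_pcompose)
  moreover have "\<bar>poly q s\<bar> \<le> 1" if "-1 \<le> s" "s \<le> 1" for s
    using bound[of "1/2 - s/2"] that by (simp add: q_def poly_pcompose)
  ultimately have "poly (pderiv q) 1 \<le> (real d)\<^sup>2" by (rule markov_at_one)
  moreover have "poly (pderiv q) 1 = - (coeff p 1) / 2"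
    by (simp add: q_def pderiv_pcompose pderiv_pCons poly_pcompose poly_0_coeff_0 coeff_pderiv)
  ultimately show ?thesis by simp
qed

section \<open>Degree of functions on the Boolean cube\<close>

text \<open>
  A point of the cube is the set \<open>A\<close> of its coordinates equal to 1, and \<open>c S\<close> is the coefficient of
  the multilinear monomial \<open>\<Prod>i\<in>S. X\<^sub>i\<close>.
\<close>

definition cube_degree_le :: "'a set \<Rightarrow> nat \<Rightarrow> ('a set \<Rightarrow> real) \<Rightarrow> bool" where
  "cube_degree_le V d F \<longleftrightarrow>
     (\<exists>c. (\<forall>A\<subseteq>V. F A = (\<Sum>S\<in>Pow A. c S)) \<and> (\<forall>S\<subseteq>V. d < card S \<longrightarrow> c S = 0))"

text \<open>The sum over \<open>Pow S\<close> determines \<open>c S\<close> once the coefficients of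
  all proper subsets of \<open>S\<close> are known, so induction along strict inclusion
  applies.\<close>

lemma cube_coeff_unique:
  fixes c c' :: "'a set \<Rightarrow> real"
  assumes "finite V" and eq: "\<And>A. A \<subseteq> V \<Longrightarrow> (\<Sum>S\<in>Pow A. c S) = (\<Sum>S\<in>Pow A. c' S)"
    and "S \<subseteq> V"
  shows "c S = c' S"
proof -
  have "finite S" using assms finite_subset by blast
  then show ?thesis using \<open>S \<subseteq> V\<close>
  proof (induction S rule: finite_psubset_induct)
    case (psubset S)
    have "(\<Sum>T\<in>Pow S - {S}. c T) = (\<Sum>T\<in>Pow S - {S}. c' T)"
      using psubset by (intro sum.cong) auto
    moreover have "(\<Sum>T\<in>Pow S. b T) = b S + (\<Sum>T\<in>Pow S - {S}. b T)" for b :: "'a set \<Rightarrow> real"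
      using psubset.hyps by (intro sum.remove) auto
    ultimately show ?case using eq[OF psubset.prems] by simp
  qed
qed

section \<open>Closure properties of the degree bound\<close>

lemma cube_degree_le_cong:
  assumes "cube_degree_le V d F" "\<And>A. A \<subseteq> V \<Longrightarrow> G A = F A"
  shows "cube_degree_le V d G"
  using assms by (simp add: cube_degree_le_def)

lemma cube_degree_le_mono: "cube_degree_le V d F \<Longrightarrow> d \<le> e \<Longrightarrow> cube_degree_le V e F"
  unfolding cube_degree_le_def by (metis le_less_trans)

lemma cube_degree_le_monomial:
  assumes "finite V" "S \<subseteq> V" "card S \<le> d"
  shows "cube_degree_le V d (\<lambda>A. of_bool (S \<subseteq> A))"
  unfolding cube_degree_le_def
proof (intro exI[of _ "\<lambda>T. of_bool (T = S)"] conjI allI impI)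
  fix A assume "A \<subseteq> V"
  then have "finite (Pow A)" using assms(1) by (simp add: finite_subset)
  then show "of_bool (S \<subseteq> A) = (\<Sum>T\<in>Pow A. of_bool (T = S) :: real)"
    by (simp add: of_bool_def sum.delta)
qed (use assms in auto)

lemma cube_degree_le_add:
  assumes "cube_degree_le V d F" "cube_degree_le V d G"
  shows "cube_degree_le V d (\<lambda>A. F A + G A)"
proof -
  obtain b c where "\<forall>A\<subseteq>V. F A = (\<Sum>S\<in>Pow A. b S)" "\<forall>S\<subseteq>V. d < card S \<longrightarrow> b S = 0"
    "\<forall>A\<subseteq>V. G A = (\<Sum>S\<in>Pow A. c S)" "\<forall>S\<subseteq>V. d < card S \<longrightarrow> c S = 0"
    using assms unfolding cube_degree_le_def by blast
  then show ?thesis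
    unfolding cube_degree_le_def by (intro exI[of _ "\<lambda>S. b S + c S"]) (auto simp: sum.distrib)
qed

lemma cube_degree_le_cmult:
  assumes "cube_degree_le V d F"
  shows "cube_degree_le V d (\<lambda>A. k * F A)"
proof -
  obtain b where "\<forall>A\<subseteq>V. F A = (\<Sum>S\<in>Pow A. b S)" "\<forall>S\<subseteq>V. d < card S \<longrightarrow> b S = 0"
    using assms unfolding cube_degree_le_def by blast
  then show ?thesis
    unfolding cube_degree_le_def by (intro exI[of _ "\<lambda>S. k * b S"]) (auto simp: sum_distrib_left)
qed

lemma cube_degree_le_const:
  assumes "finite V"
  shows "cube_degree_le V d (\<lambda>A. k)"
  using cube_degree_le_cmult[OF cube_degree_le_monomial[OF assms, of "{}" d], of k] by simp

lemma cube_degree_le_diff: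
  assumes "cube_degree_le V d F" "cube_degree_le V d G"
  shows "cube_degree_le V d (\<lambda>A. F A - G A)"
  using cube_degree_le_add[OF assms(1) cube_degree_le_cmult[OF assms(2), of "-1"]] by simp

lemma cube_degree_le_sum:
  assumes "finite V" "\<And>i. i \<in> I \<Longrightarrow> cube_degree_le V d (F i)"
  shows "cube_degree_le V d (\<lambda>A. \<Sum>i\<in>I. F i A)"
  using assms(2)
  by (induction I rule: infinite_finite_induct)
    (auto intro: cube_degree_le_add cube_degree_le_const[OF assms(1)])

text \<open>Makes the index set independent of \<open>A\<close>, so that a function becomes a fixed
  linear combination of monomials and products can be expanded.\<close>

lemma sum_Pow_eq_sum_monomials:
  fixes c :: "'a set \<Rightarrow> real"
  assumes "finite V" "A \<subseteq> V"
  shows "(\<Sum>S\<in>Pow A. c S) = (\<Sum>S\<in>Pow V. c S * of_bool (S \<subseteq> A))"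
proof -
  have "(\<Sum>S\<in>Pow A. c S) = (\<Sum>S\<in>Pow A. c S * of_bool (S \<subseteq> A))"
    by (intro sum.cong) auto
  also have "\<dots> = (\<Sum>S\<in>Pow V. c S * of_bool (S \<subseteq> A))"
    using assms by (intro sum.mono_neutral_left) auto
  finally show ?thesis .
qed

lemma cube_degree_le_expand:
  assumes "finite V" "cube_degree_le V d F"
  obtains c where "\<And>A. A \<subseteq> V \<Longrightarrow> F A = (\<Sum>S\<in>Pow V. c S * of_bool (S \<subseteq> A))"
    "\<And>S. S \<subseteq> V \<Longrightarrow> d < card S \<Longrightarrow> c S = 0"
proof -
  obtain c where c: "\<And>A. A \<subseteq> V \<Longrightarrow> F A = (\<Sum>S\<in>Pow A. c S)"
    "\<And>S. S \<subseteq> V \<Longrightarrow> d < card S \<Longrightarrow> c S = 0"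
    using assms(2) unfolding cube_degree_le_def by blast
  show ?thesis
  proof (rule that[of c])
    fix A assume "A \<subseteq> V"
    then show "F A = (\<Sum>S\<in>Pow V. c S * of_bool (S \<subseteq> A))"
      unfolding c(1)[OF \<open>A \<subseteq> V\<close>] by (rule sum_Pow_eq_sum_monomials[OF assms(1)])
  qed (rule c(2))
qed

text \<open>On the cube the monomials of \<open>S\<close> and \<open>T\<close> multiply to that of
  \<open>S \<union> T\<close>, whose size is at most the sum of the two sizes.\<close>

lemma cube_degree_le_mult:
  assumes "finite V" "cube_degree_le V d F" "cube_degree_le V e G"
  shows "cube_degree_le V (d + e) (\<lambda>A. F A * G A)"
proof -
  obtain b where b: "\<And>A. A \<subseteq> V \<Longrightarrow> F A = (\<Sum>S\<in>Pow V. b S * of_bool (S \<subseteq> A))"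
    "\<And>S. S \<subseteq> V \<Longrightarrow> d < card S \<Longrightarrow> b S = 0"
    using cube_degree_le_expand[OF assms(1,2)] by blast
  obtain c where c: "\<And>A. A \<subseteq> V \<Longrightarrow> G A = (\<Sum>S\<in>Pow V. c S * of_bool (S \<subseteq> A))"
    "\<And>S. S \<subseteq> V \<Longrightarrow> e < card S \<Longrightarrow> c S = 0"
    using cube_degree_le_expand[OF assms(1,3)] by blast
  have "F A * G A = (\<Sum>S\<in>Pow V. \<Sum>T\<in>Pow V. (b S * c T) * of_bool (S \<union> T \<subseteq> A))"
    if "A \<subseteq> V" for A
    unfolding b(1)[OF that] c(1)[OF that] sum_product
    by (intro sum.cong refl) auto
  moreover have "cube_degree_le V (d + e)
    (\<lambda>A. \<Sum>S\<in>Pow V. \<Sum>T\<in>Pow V. (b S * c T) * of_bool (S \<union> T \<subseteq> A))"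
  proof (intro cube_degree_le_sum assms(1))
    fix S T assume *: "S \<in> Pow V" "T \<in> Pow V"
    show "cube_degree_le V (d + e) (\<lambda>A. (b S * c T) * of_bool (S \<union> T \<subseteq> A))"
    proof (cases "card S \<le> d \<and> card T \<le> e")
      case True
      then show ?thesis
        using * card_Un_le[of S T] assms(1)
        by (intro cube_degree_le_cmult cube_degree_le_monomial) auto
    next
      case False
      then have z: "b S * c T = 0" using b(2) c(2) * by auto
      show ?thesis unfolding z using cube_degree_le_const[OF assms(1)] by simp
    qed
  qed
  ultimately show ?thesis by (rule cube_degree_le_cong[rotated])
qed

lemma cube_degree_le_prod:
  assumes "finite V" "\<And>i. i \<in> I \<Longrightarrow> cube_degree_le V 1 (F i)"
  shows "cube_degree_le V (card I) (\<lambda>A. \<Prod>i\<in>I. F i A)"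
  using assms(2)
proof (induction I rule: infinite_finite_induct)
  case (insert i I)
  then have "cube_degree_le V (1 + card I) (\<lambda>A. F i A * (\<Prod>i\<in>I. F i A))"
    by (intro cube_degree_le_mult assms(1)) auto
  then show ?case using insert by simp
qed (auto intro: cube_degree_le_const[OF assms(1)])

lemma cube_degree_le_mem:
  assumes "finite V" "i \<in> V"
  shows "cube_degree_le V 1 (\<lambda>A. of_bool (i \<in> A))"
  using cube_degree_le_monomial[of V "{i}" 1] assms by simp

lemma prod_of_bool: "finite I \<Longrightarrow> (\<Prod>i\<in>I. of_bool (P i)) = (of_bool (\<forall>i\<in>I. P i) :: real)"
  by (induction I rule: finite_induct) auto

text \<open>The indicator of a subcube is a product with one factor for each i in \<open>Q\<close>:
  X_i if i lies in \<open>a\<close>, and 1 - X_i otherwise.\<close>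

lemma cube_degree_le_inter_eq:
  assumes "finite V" "Q \<subseteq> V" "a \<subseteq> Q"
  shows "cube_degree_le V (card Q) (\<lambda>A. of_bool (A \<inter> Q = a))"
proof -
  have "cube_degree_le V (card Q) (\<lambda>A. \<Prod>i\<in>Q. of_bool (i \<in> A \<longleftrightarrow> i \<in> a))"
  proof (rule cube_degree_le_prod[OF assms(1)])
    fix i assume "i \<in> Q"
    then have mem: "cube_degree_le V 1 (\<lambda>A. of_bool (i \<in> A))"
      using assms(2) by (intro cube_degree_le_mem assms(1)) auto
    show "cube_degree_le V 1 (\<lambda>A. of_bool (i \<in> A \<longleftrightarrow> i \<in> a))"
    proof (cases "i \<in> a")
      case False
      then show ?thesis
        using cube_degree_le_diff[OF cube_degree_le_const[OF assms(1), of 1 1] mem]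
        by (simp add: of_bool_not_iff)
    qed (use mem in simp)
  qed
  moreover have "(\<Prod>i\<in>Q. of_bool (i \<in> A \<longleftrightarrow> i \<in> a)) = (of_bool (A \<inter> Q = a) :: real)" for A
  proof -
    have "(\<forall>i\<in>Q. i \<in> A \<longleftrightarrow> i \<in> a) \<longleftrightarrow> A \<inter> Q = a" using assms(3) by blast
    then show ?thesis using finite_subset[OF assms(2,1)] by (simp add: prod_of_bool)
  qed
  ultimately show ?thesis by simp
qed

text \<open>Interpolation: \<open>F\<close> is the sum of its values times the indicators of single
  points.\<close>

lemma cube_degree_le_card:
  assumes "finite V"
  shows "cube_degree_le V (card V) F"
proof -
  have "cube_degree_le V (card V) (\<lambda>A. \<Sum>B\<in>Pow V. F B * of_bool (A \<inter> V = B))"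
    using assms by (intro cube_degree_le_sum cube_degree_le_cmult cube_degree_le_inter_eq) auto
  moreover have "F A = (\<Sum>B\<in>Pow V. F B * of_bool (A \<inter> V = B))" if "A \<subseteq> V" for A
  proof -
    have "(\<Sum>B\<in>Pow V. F B * of_bool (A \<inter> V = B)) = (\<Sum>B\<in>Pow V. if A = B then F B else 0)"
      using that by (intro sum.cong) (auto simp: Int_absorb2)
    then show ?thesis using that assms by simp
  qed
  ultimately show ?thesis by (rule cube_degree_le_cong)
qed

text \<open>A monomial of size k turns into a product of k functions of degree at most 1. This
  covers both fixing some variables and letting one new variable control a whole block of old
  ones.\<close>

lemma cube_degree_le_substitute:
  assumes "finite V" "finite W" "cube_degree_le V d F"
    and sub: "\<And>A. A \<subseteq> W \<Longrightarrow> \<phi> A \<subseteq> V"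
    and lin: "\<And>i. i \<in> V \<Longrightarrow> cube_degree_le W 1 (\<lambda>A. of_bool (i \<in> \<phi> A))"
  shows "cube_degree_le W d (\<lambda>A. F (\<phi> A))"
proof -
  obtain c where c: "\<And>A. A \<subseteq> V \<Longrightarrow> F A = (\<Sum>S\<in>Pow V. c S * of_bool (S \<subseteq> A))"
    "\<And>S. S \<subseteq> V \<Longrightarrow> d < card S \<Longrightarrow> c S = 0"
    using cube_degree_le_expand[OF assms(1,3)] by blast
  have "cube_degree_le W d (\<lambda>A. \<Sum>S\<in>Pow V. c S * (\<Prod>i\<in>S. of_bool (i \<in> \<phi> A)))"
  proof (intro cube_degree_le_sum assms(2))
    fix S assume S: "S \<in> Pow V"
    show "cube_degree_le W d (\<lambda>A. c S * (\<Prod>i\<in>S. of_bool (i \<in> \<phi> A)))"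
    proof (cases "card S \<le> d")
      case True
      have "cube_degree_le W (card S) (\<lambda>A. \<Prod>i\<in>S. of_bool (i \<in> \<phi> A))"
        using S lin by (intro cube_degree_le_prod assms(2)) auto
      then show ?thesis using True by (rule cube_degree_le_cmult[OF cube_degree_le_mono])
    next
      case False
      then show ?thesis using c(2) S cube_degree_le_const[OF assms(2)] by simp
    qed
  qed
  moreover have "F (\<phi> A) = (\<Sum>S\<in>Pow V. c S * (\<Prod>i\<in>S. of_bool (i \<in> \<phi> A)))" if "A \<subseteq> W" for A
    unfolding c(1)[OF sub[OF that]]
    using assms(1) by (intro sum.cong refl) (auto simp: prod_of_bool finite_subset subset_iff)
  ultimately show ?thesis by (rule cube_degree_le_cong)
qed

text \<open>Every subset of the union splits uniquely into a part \<open>R\<close> in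
  \<open>A\<close> and a part \<open>S\<close> in \<open>B\<close>. The inner sum is the coefficient
  of \<open>S\<close> after the variables in \<open>A\<close> have been set to 1.\<close>

lemma sum_Pow_Un_disjoint:
  fixes c :: "'a set \<Rightarrow> real"
  assumes "finite A" "finite B" "A \<inter> B = {}"
  shows "(\<Sum>S\<in>Pow (A \<union> B). c S) = (\<Sum>S\<in>Pow B. \<Sum>R\<in>Pow A. c (R \<union> S))"
proof -
  have "(\<Sum>S\<in>Pow (A \<union> B). c S) = (\<Sum>(S,R)\<in>Pow B \<times> Pow A. c (R \<union> S))"
    by (rule sum.reindex_bij_witness[of _ "\<lambda>(S,R). R \<union> S" "\<lambda>S. (S \<inter> B, S \<inter> A)"])
      (use assms(3) in \<open>auto intro!: arg_cong[where f = c]\<close>)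
  then show ?thesis by (simp add: sum.cartesian_product)
qed

text \<open>
  The sum is the expectation of \<open>\<Sum>S\<in>Pow I. c S\<close> for a random \<open>I \<subseteq> W\<close> that contains each
  element independently with probability \<open>t\<close>.
\<close>

lemma abs_multilinear_extension_le_one:
  fixes c :: "'a set \<Rightarrow> real"
  assumes "finite W" "0 \<le> t" "t \<le> 1" "\<And>I. I \<subseteq> W \<Longrightarrow> \<bar>\<Sum>S\<in>Pow I. c S\<bar> \<le> 1"
  shows "\<bar>\<Sum>S\<in>Pow W. c S * t ^ card S\<bar> \<le> 1"
  using assms(1,4)
proof (induction W arbitrary: c rule: finite_induct)
  case empty
  then show ?case by force
next
  case (insert w W)
  have split: "(\<Sum>S\<in>Pow (insert w I). b S) = (\<Sum>S\<in>Pow I. b S + b (insert w S))"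
    if "I \<subseteq> W" for I and b :: "'a set \<Rightarrow> real"
  proof -
    have "finite I" "w \<notin> I" using that insert finite_subset by blast+
    then have "(\<Sum>S\<in>Pow ({w} \<union> I). b S) = (\<Sum>S\<in>Pow I. \<Sum>R\<in>Pow {w}. b (R \<union> S))"
      by (intro sum_Pow_Un_disjoint) auto
    then show ?thesis by (simp add: Pow_insert add.commute)
  qed
  \<comment> \<open>Substituting \<open>t\<close> for the variable \<open>w\<close> gives these
    coefficients. The resulting value at \<open>I\<close> is the convex combination of the values at
    \<open>I\<close> and \<open>insert w I\<close>, hence still bounded by 1.\<close>
  have "\<bar>\<Sum>S\<in>Pow W. (c S + t * c (insert w S)) * t ^ card S\<bar> \<le> 1"
  proof (rule insert.IH)
    fix I assume I: "I \<subseteq> W"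
    let ?a = "\<Sum>S\<in>Pow I. c S" and ?b = "\<Sum>S\<in>Pow (insert w I). c S"
    have "(\<Sum>S\<in>Pow I. c S + t * c (insert w S)) = (1 - t) * ?a + t * ?b"
      unfolding split[OF I] sum.distrib sum_distrib_left[symmetric] by (simp add: algebra_simps)
    also have "\<bar>\<dots>\<bar> \<le> (1 - t) * \<bar>?a\<bar> + t * \<bar>?b\<bar>"
      using assms(2,3) abs_triangle_ineq[of "(1 - t) * ?a" "t * ?b"] by (simp add: abs_mult)
    also have "\<dots> \<le> (1 - t) * 1 + t * 1"
      using assms(2,3) I insert.prems[of I] insert.prems[of "insert w I"]
      by (intro add_mono mult_left_mono) auto
    finally show "\<bar>\<Sum>S\<in>Pow I. c S + t * c (insert w S)\<bar> \<le> 1" by simp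
  qed
  moreover have "(\<Sum>S\<in>Pow (insert w W). c S * t ^ card S)
      = (\<Sum>S\<in>Pow W. (c S + t * c (insert w S)) * t ^ card S)"
    unfolding split[OF subset_refl]
  proof (intro sum.cong refl)
    fix S assume "S \<in> Pow W"
    then have "card (insert w S) = Suc (card S)"
      using insert.hyps finite_subset[of S W] by (intro card_insert_disjoint) auto
    then show "c S * t ^ card S + c (insert w S) * t ^ card (insert w S)
      = (c S + t * c (insert w S)) * t ^ card S" by (simp add: algebra_simps)
  qed
  ultimately show ?case by simp
qed

section \<open>Degree of the support of a polynomial\<close>

text \<open>Let \<open>p\<close> be the expectation of \<open>G\<close> at a random subset of
  \<open>W\<close> containing each element independently with probability t. It has degree at most
  \<open>d\<close> and is bounded by 1 on [0,1]. Each singleton has coefficient 0 - 1, so the linear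
  coefficient is minus the size of \<open>W\<close>, and Markov's inequality at 0 applies.\<close>

lemma card_sensitive_le:
  assumes "finite W" "cube_degree_le W d G" and bound: "\<And>I. I \<subseteq> W \<Longrightarrow> \<bar>G I\<bar> \<le> 1"
    and "G {} = 1" "\<And>w. w \<in> W \<Longrightarrow> G {w} = 0"
  shows "card W \<le> 2 * d\<^sup>2"
proof -
  obtain c where c: "\<And>I. I \<subseteq> W \<Longrightarrow> G I = (\<Sum>S\<in>Pow I. c S)"
    "\<And>S. S \<subseteq> W \<Longrightarrow> d < card S \<Longrightarrow> c S = 0"
    using assms(2) unfolding cube_degree_le_def by blast
  define p where "p = (\<Sum>S\<in>Pow W. monom (c S) (card S))"
  have "degree (monom (c S) (card S)) \<le> d" if "S \<subseteq> W" for S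
    using c(2)[OF that] by (cases "d < card S") (auto intro: order.trans[OF degree_monom_le])
  then have "degree p \<le> d"
    unfolding p_def using assms(1) by (intro degree_sum_le) auto
  moreover have "\<bar>poly p t\<bar> \<le> 1" if "0 \<le> t" "t \<le> 1" for t
    using abs_multilinear_extension_le_one[OF assms(1) that, of c] bound c(1)
    by (simp add: p_def poly_sum poly_monom)
  ultimately have "- coeff p 1 \<le> 2 * (real d)\<^sup>2" by (rule markov_at_zero)
  moreover have "coeff p 1 = - real (card W)"
  proof -
    have "coeff p 1 = (\<Sum>S\<in>Pow W. if card S = 1 then c S else 0)"
      by (simp add: p_def coeff_sum)
    also have "\<dots> = (\<Sum>S\<in>{S \<in> Pow W. card S = 1}. c S)"
      using assms(1) by (intro sum.inter_filter[symmetric]) simp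
    also have "{S \<in> Pow W. card S = 1} = (\<lambda>w. {w}) ` W"
      by (auto simp: card_1_singleton_iff)
    also have "(\<Sum>S\<in>(\<lambda>w. {w}) ` W. c S) = (\<Sum>w\<in>W. c {w})"
      by (subst sum.reindex) auto
    also have "\<dots> = (\<Sum>w\<in>W. -1)"
    proof (intro sum.cong refl)
      fix w assume "w \<in> W"
      then have "G {w} = c {} + c {w}" "G {} = c {}"
        using c(1)[of "{w}"] c(1)[of "{}"] by (auto simp: Pow_insert)
      then show "c {w} = -1" using assms(4) assms(5)[OF \<open>w \<in> W\<close>] by simp
    qed
    finally show ?thesis by simp
  qed
  ultimately have "real (card W) \<le> real (2 * d\<^sup>2)" by simp
  then show ?thesis by (simp only: of_nat_le_iff)
qed

text \<open>Fix the variables outside \<open>M\<close> as in \<open>x\<close>. In the remaining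
  polynomial in the variables of \<open>M\<close>, the coefficient of \<open>M\<close> is the sum of
  \<open>c (R \<union> M)\<close> over \<open>R \<subseteq> x - M\<close>. Only
  \<open>R = {}\<close> contributes, since \<open>M\<close> has maximal size, so this coefficient is
  \<open>c M\<close> and the restriction is not identically zero.\<close>

lemma top_monomial_nonvanishing:
  fixes c :: "'a set \<Rightarrow> real"
  assumes "finite V" and F: "\<And>A. A \<subseteq> V \<Longrightarrow> F A = (\<Sum>S\<in>Pow A. c S)"
    and deg: "\<And>S. S \<subseteq> V \<Longrightarrow> card M < card S \<Longrightarrow> c S = 0"
    and "M \<subseteq> V" "c M \<noteq> 0" "x \<subseteq> V"
  shows "\<exists>Y\<subseteq>M. F ((x - M) \<union> Y) \<noteq> 0"
proof (rule ccontr)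
  assume neg: "\<not> ?thesis"
  have fin: "finite M" "finite (x - M)" using assms(1,4,6) by (auto intro: finite_subset finite_Diff)
  have "(\<Sum>R\<in>Pow (x - M). c (R \<union> M)) = 0"
  proof (rule cube_coeff_unique[OF fin(1),
        where c = "\<lambda>S. \<Sum>R\<in>Pow (x - M). c (R \<union> S)" and c' = "\<lambda>_. 0"])
    fix Y assume Y: "Y \<subseteq> M"
    have "F ((x - M) \<union> Y) = (\<Sum>S\<in>Pow Y. \<Sum>R\<in>Pow (x - M). c (R \<union> S))"
      using Y assms(4,6) fin finite_subset[OF Y fin(1)]
      by (subst F, blast) (rule sum_Pow_Un_disjoint, auto)
    then show "(\<Sum>S\<in>Pow Y. \<Sum>R\<in>Pow (x - M). c (R \<union> S)) = (\<Sum>S\<in>Pow Y. 0)"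
      using neg Y by simp
  qed simp
  moreover have "(\<Sum>R\<in>Pow (x - M). c (R \<union> M)) = (\<Sum>R\<in>{{}}. c (R \<union> M))"
  proof (rule sum.mono_neutral_right)
    show "\<forall>R\<in>Pow (x - M) - {{}}. c (R \<union> M) = 0"
    proof
      fix R assume R: "R \<in> Pow (x - M) - {{}}"
      have "card M < card (R \<union> M)"
        using R fin finite_subset[of R "x - M"] by (intro psubset_card_mono) auto
      moreover have "R \<union> M \<subseteq> V" using R assms(4,6) by auto
      ultimately show "c (R \<union> M) = 0" by (rule deg[rotated])
    qed
  qed (use fin in auto)
  ultimately show False using assms(5) by simp
qed

lemma card_disjoint_top_monomials_le:
  fixes c :: "'a set \<Rightarrow> real"
  assumes "finite V" and F\<^sub>1: "\<And>A. A \<subseteq> V \<Longrightarrow> F\<^sub>1 A = (\<Sum>S\<in>Pow A. c S)"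
    and deg: "\<And>S. S \<subseteq> V \<Longrightarrow> e < card S \<Longrightarrow> c S = 0"
    and F\<^sub>2: "cube_degree_le V d F\<^sub>2"
    and prod: "\<And>A. A \<subseteq> V \<Longrightarrow> F\<^sub>1 A * F\<^sub>2 A = 0"
    and nonzero: "x\<^sub>0 \<subseteq> V" "F\<^sub>2 x\<^sub>0 \<noteq> 0"
    and top: "\<And>M. M \<in> \<M> \<Longrightarrow> M \<subseteq> V \<and> card M = e \<and> c M \<noteq> 0"
    and disj: "pairwise disjnt \<M>"
  shows "card \<M> \<le> 2 * d\<^sup>2"
proof -
  have fin: "finite \<M>"
    using top assms(1) by (intro finite_subset[of \<M> "Pow V"]) auto
  define m where "m = Max ((\<lambda>A. \<bar>F\<^sub>2 A\<bar>) ` Pow V)"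
  have "m \<in> (\<lambda>A. \<bar>F\<^sub>2 A\<bar>) ` Pow V"
    unfolding m_def using assms(1) by (intro Max_in) auto
  then obtain x where x: "x \<subseteq> V" "m = \<bar>F\<^sub>2 x\<bar>" by auto
  have x_max: "\<bar>F\<^sub>2 A\<bar> \<le> \<bar>F\<^sub>2 x\<bar>" if "A \<subseteq> V" for A
    unfolding x(2)[symmetric] m_def using that assms(1) by (intro Max_ge) auto
  have F\<^sub>2x: "F\<^sub>2 x \<noteq> 0" using x_max[OF nonzero(1)] nonzero(2) by auto
  have "\<forall>M\<in>\<M>. \<exists>Y. Y \<subseteq> M \<and> F\<^sub>1 ((x - M) \<union> Y) \<noteq> 0"
  proof
    fix M assume "M \<in> \<M>"
    then show "\<exists>Y. Y \<subseteq> M \<and> F\<^sub>1 ((x - M) \<union> Y) \<noteq> 0"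
      using top_monomial_nonvanishing[OF assms(1), of F\<^sub>1 c M x] F\<^sub>1 deg top[of M] x(1) by blast
  qed
  from bchoice[OF this] obtain Y
    where Y: "\<And>M. M \<in> \<M> \<Longrightarrow> Y M \<subseteq> M" "\<And>M. M \<in> \<M> \<Longrightarrow> F\<^sub>1 ((x - M) \<union> Y M) \<noteq> 0"
    by blast
  \<comment> \<open>The point obtained from \<open>x\<close> by making the change \<open>Y M\<close>
    on every block \<open>M\<close> in \<open>I\<close>. Changing a single block makes
    \<open>F\<^sub>1\<close> nonzero and hence \<open>F\<^sub>2\<close> zero.\<close>
  define \<phi> where "\<phi> I = (x - \<Union>I) \<union> \<Union>(Y ` I)" for I
  have \<phi>_sub: "\<phi> I \<subseteq> V" if "I \<subseteq> \<M>" for I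
  proof
    fix i assume "i \<in> \<phi> I"
    then consider "i \<in> x" | M where "M \<in> I" "i \<in> Y M" unfolding \<phi>_def by blast
    then show "i \<in> V"
    proof cases
      case 2
      then show ?thesis using Y(1)[of M] top[of M] that by blast
    qed (use x in auto)
  qed
  have "cube_degree_le \<M> d (\<lambda>I. F\<^sub>2 (\<phi> I))"
  proof (rule cube_degree_le_substitute[OF assms(1) fin F\<^sub>2 \<phi>_sub])
    fix i assume "i \<in> V"
    show "cube_degree_le \<M> 1 (\<lambda>I. of_bool (i \<in> \<phi> I))"
    proof (cases "\<exists>M\<in>\<M>. i \<in> M")
      case True
      then obtain M where M: "M \<in> \<M>" "i \<in> M" by blast
      have uniq: "N = M" if "N \<in> \<M>" "i \<in> N" for N
        using disj M that unfolding pairwise_def disjnt_def by blast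
      \<comment> \<open>By disjointness only the block \<open>M\<close> affects coordinate
        \<open>i\<close>, which switches from its value in \<open>x\<close> to its value in
        \<open>Y M\<close>. This is affine in the indicator of \<open>M \<in> I\<close>.\<close>
      have "cube_degree_le \<M> 1
        (\<lambda>I. of_bool (i \<in> x) + (of_bool (i \<in> Y M) - of_bool (i \<in> x)) * of_bool (M \<in> I))"
        by (intro cube_degree_le_add cube_degree_le_cmult cube_degree_le_const cube_degree_le_mem fin M)
      then show ?thesis
      proof (rule cube_degree_le_cong)
        fix I assume I: "I \<subseteq> \<M>"
        have "i \<in> \<phi> I \<longleftrightarrow> (if M \<in> I then i \<in> Y M else i \<in> x)"
        proof (cases "M \<in> I")
          case True
          have "i \<in> Y N \<Longrightarrow> N \<in> I \<Longrightarrow> i \<in> Y M" for N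
            using uniq[of N] Y(1)[of N] I by blast
          then show ?thesis using True M unfolding \<phi>_def by auto
        next
          case False
          have "i \<notin> Y N" "i \<notin> N" if "N \<in> I" for N
            using uniq[of N] Y(1)[of N] I False that by blast+
          then show ?thesis using False unfolding \<phi>_def by auto
        qed
        then show "of_bool (i \<in> \<phi> I)
          = of_bool (i \<in> x) + (of_bool (i \<in> Y M) - of_bool (i \<in> x)) * (of_bool (M \<in> I) :: real)"
          by simp
      qed
    next
      case False
      have "cube_degree_le \<M> 1 (\<lambda>I. of_bool (i \<in> x))"
        by (rule cube_degree_le_const[OF fin])
      then show ?thesis
      proof (rule cube_degree_le_cong)
        fix I assume I: "I \<subseteq> \<M>"
        have "i \<in> \<phi> I \<longleftrightarrow> i \<in> x"
          using False I Y(1) unfolding \<phi>_def by blast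
        then show "of_bool (i \<in> \<phi> I) = (of_bool (i \<in> x) :: real)" by simp
      qed
    qed
  qed
  then have deg_G: "cube_degree_le \<M> d (\<lambda>I. (1 / F\<^sub>2 x) * F\<^sub>2 (\<phi> I))"
    by (rule cube_degree_le_cmult)
  show ?thesis
  proof (rule card_sensitive_le[OF fin deg_G])
    fix I assume "I \<subseteq> \<M>"
    then show "\<bar>(1 / F\<^sub>2 x) * F\<^sub>2 (\<phi> I)\<bar> \<le> 1"
      using x_max[OF \<phi>_sub] F\<^sub>2x by (simp add: abs_mult field_simps)
  next
    show "(1 / F\<^sub>2 x) * F\<^sub>2 (\<phi> {}) = 1" using F\<^sub>2x by (simp add: \<phi>_def)
  next
    fix M assume M: "M \<in> \<M>"
    have "F\<^sub>1 (\<phi> {M}) \<noteq> 0" using Y(2)[OF M] by (simp add: \<phi>_def)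
    then have "F\<^sub>2 (\<phi> {M}) = 0" using prod[OF \<phi>_sub[of "{M}"]] M by simp
    then show "(1 / F\<^sub>2 x) * F\<^sub>2 (\<phi> {M}) = 0" by simp
  qed
qed

text \<open>A nonempty member of \<open>\<T>\<close> that missed the union of an inclusion-maximal
  disjoint family could be added to it. The union is therefore a hitting set.\<close>

lemma exists_maximal_disjoint_family:
  assumes "finite \<T>"
  obtains \<M> where "\<M> \<subseteq> \<T>" "pairwise disjnt \<M>" "\<And>M. M \<in> \<T> \<Longrightarrow> M \<noteq> {} \<Longrightarrow> M \<inter> \<Union>\<M> \<noteq> {}"
proof -
  have "finite {\<M>. \<M> \<subseteq> \<T> \<and> pairwise disjnt \<M>}" "{} \<in> {\<M>. \<M> \<subseteq> \<T> \<and> pairwise disjnt \<M>}"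
    using assms by auto
  from finite_has_maximal2[OF this] obtain \<M> where \<M>: "\<M> \<subseteq> \<T>" "pairwise disjnt \<M>"
    and max: "\<And>\<N>. \<N> \<subseteq> \<T> \<Longrightarrow> pairwise disjnt \<N> \<Longrightarrow> \<M> \<subseteq> \<N> \<Longrightarrow> \<M> = \<N>"
    by auto
  have "M \<inter> \<Union>\<M> \<noteq> {}" if "M \<in> \<T>" "M \<noteq> {}" for M
  proof
    assume disj: "M \<inter> \<Union>\<M> = {}"
    then have "pairwise disjnt (insert M \<M>)"
      using \<M>(2) by (auto simp: pairwise_insert disjnt_def)
    then have "M \<in> \<M>" using max[of "insert M \<M>"] \<M>(1) that by auto
    then show False using disj that by blast
  qed
  then show ?thesis using that \<M> by blast
qed

text \<open>After the variables in \<open>Q\<close> are fixed by \<open>a\<close>, the coefficient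
  of \<open>S\<close> is the sum of \<open>c (R \<union> S)\<close> over
  \<open>R \<subseteq> a\<close>. If \<open>S\<close> has more than \<open>e\<close> elements, a
  nonzero term forces \<open>R = {}\<close> and \<open>S\<close> of size \<open>Suc e\<close>, so
  \<open>S\<close> would be a top monomial avoiding \<open>Q\<close>.\<close>

lemma cube_degree_le_restrict_below_top:
  fixes c :: "'a set \<Rightarrow> real"
  assumes "finite V" and F: "\<And>A. A \<subseteq> V \<Longrightarrow> F A = (\<Sum>S\<in>Pow A. c S)"
    and deg: "\<And>S. S \<subseteq> V \<Longrightarrow> Suc e < card S \<Longrightarrow> c S = 0"
    and hit: "\<And>M. M \<subseteq> V \<Longrightarrow> card M = Suc e \<Longrightarrow> c M \<noteq> 0 \<Longrightarrow> M \<inter> Q \<noteq> {}"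
    and "a \<subseteq> Q" "Q \<subseteq> V"
  shows "cube_degree_le (V - Q) e (\<lambda>A. F (a \<union> A))"
  unfolding cube_degree_le_def
proof (intro exI[of _ "\<lambda>S. \<Sum>R\<in>Pow a. c (R \<union> S)"] conjI allI impI)
  fix A assume A: "A \<subseteq> V - Q"
  then have "finite a" "finite A" "a \<inter> A = {}" "a \<union> A \<subseteq> V"
    using assms(1,5,6) finite_subset[of a V] finite_subset[of A V] by auto
  then show "F (a \<union> A) = (\<Sum>S\<in>Pow A. \<Sum>R\<in>Pow a. c (R \<union> S))"
    by (simp add: F sum_Pow_Un_disjoint)
next
  fix S assume S: "S \<subseteq> V - Q" "e < card S"
  have "c (R \<union> S) = 0" if "R \<subseteq> a" for R
  proof (rule ccontr)
    assume nz: "c (R \<union> S) \<noteq> 0"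
    have sub: "R \<union> S \<subseteq> V" and fin: "finite R" "finite S"
      using that S assms(1,5,6) finite_subset[of R V] finite_subset[of S V] by auto
    have "card (R \<union> S) = card R + card S"
      using fin S that assms(5) by (intro card_Un_disjoint) auto
    then have "card R = 0" "card S = Suc e"
      using deg[OF sub] nz S(2) by linarith+
    then show False using hit[of S] nz S(1) fin by auto
  qed
  then show "(\<Sum>R\<in>Pow a. c (R \<union> S)) = 0" by simp
qed

text \<open>Induction on \<open>e\<close>: a hitting set \<open>Q\<close> of the top monomials has
  at most 2 d^2 (e+1) elements, and fixing its variables lowers the degree of
  \<open>F\<^sub>1\<close> while preserving the hypotheses. The indicators of the resulting
  subcubes, each times the indicator from the induction hypothesis, add up to the wanted
  function.\<close>

theorem cube_degree_le_support:
  assumes "finite V" "cube_degree_le V e F\<^sub>1" "cube_degree_le V d F\<^sub>2"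
    and "\<And>A. A \<subseteq> V \<Longrightarrow> F\<^sub>1 A * F\<^sub>2 A = 0" "\<And>A. A \<subseteq> V \<Longrightarrow> \<not> (F\<^sub>1 A = 0 \<and> F\<^sub>2 A = 0)"
  shows "cube_degree_le V (2 * e\<^sup>2 * d\<^sup>2) (\<lambda>A. of_bool (F\<^sub>1 A \<noteq> 0))"
  using assms
proof (induction e arbitrary: V F\<^sub>1 F\<^sub>2)
  case 0
  obtain c where c: "\<And>A. A \<subseteq> V \<Longrightarrow> F\<^sub>1 A = (\<Sum>S\<in>Pow A. c S)"
    "\<And>S. S \<subseteq> V \<Longrightarrow> 0 < card S \<Longrightarrow> c S = 0"
    using 0(2) unfolding cube_degree_le_def by blast
  have "F\<^sub>1 A = c {}" if "A \<subseteq> V" for A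
  proof -
    have "finite A" using that 0(1) finite_subset by blast
    then have "(\<Sum>S\<in>Pow A. c S) = (\<Sum>S\<in>{{}}. c S)"
    proof (intro sum.mono_neutral_right ballI)
      fix S assume S: "S \<in> Pow A - {{}}"
      then have "0 < card S" using finite_subset[of S A] \<open>finite A\<close> by (auto simp: card_gt_0_iff)
      then show "c S = 0" using c(2)[of S] S that by auto
    qed auto
    then show ?thesis using c(1)[OF that] by simp
  qed
  then show ?case
    using cube_degree_le_const[OF 0(1), of _ "of_bool (c {} \<noteq> 0)"] by (rule_tac cube_degree_le_cong) auto
next
  case (Suc e)
  note fin = Suc.prems(1)
  show ?case
  \<comment> \<open>A zero of \<open>F\<^sub>1\<close> supplies a point where
    \<open>F\<^sub>2\<close> is nonzero, which the bound on disjoint families requires. Without such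
    a zero the indicator is constant.\<close>
  proof (cases "\<forall>A\<subseteq>V. F\<^sub>1 A \<noteq> 0")
    case True
    then show ?thesis
      using cube_degree_le_const[OF fin, of _ 1] by (rule_tac cube_degree_le_cong) auto
  next
    case False
    then obtain x\<^sub>0 where x\<^sub>0: "x\<^sub>0 \<subseteq> V" "F\<^sub>2 x\<^sub>0 \<noteq> 0" using Suc.prems(5) by blast
    obtain c where c: "\<And>A. A \<subseteq> V \<Longrightarrow> F\<^sub>1 A = (\<Sum>S\<in>Pow A. c S)"
      "\<And>S. S \<subseteq> V \<Longrightarrow> Suc e < card S \<Longrightarrow> c S = 0"
      using Suc.prems(2) unfolding cube_degree_le_def by blast
    define \<T> where "\<T> = {M. M \<subseteq> V \<and> card M = Suc e \<and> c M \<noteq> 0}"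
    have "finite \<T>" unfolding \<T>_def using fin by simp
    then obtain \<M> where \<M>: "\<M> \<subseteq> \<T>" "pairwise disjnt \<M>"
      and hit: "\<And>M. M \<in> \<T> \<Longrightarrow> M \<noteq> {} \<Longrightarrow> M \<inter> \<Union>\<M> \<noteq> {}"
      using exists_maximal_disjoint_family by blast
    have "card \<M> \<le> 2 * d\<^sup>2"
      using card_disjoint_top_monomials_le[OF fin c Suc.prems(3,4) x\<^sub>0 _ \<M>(2)] \<M>(1)
      unfolding \<T>_def by blast
    define Q where "Q = \<Union>\<M>"
    have Q: "Q \<subseteq> V" "finite Q"
      using \<M>(1) fin finite_subset[of Q V] unfolding Q_def \<T>_def by blast+
    have "card Q \<le> (\<Sum>M\<in>\<M>. card M)"
      unfolding Q_def by (rule card_Union_le_sum_card)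
    also have "\<dots> = (\<Sum>M\<in>\<M>. Suc e)"
      using \<M>(1) unfolding \<T>_def by (intro sum.cong) auto
    also have "\<dots> \<le> 2 * d\<^sup>2 * Suc e"
      using \<open>card \<M> \<le> 2 * d\<^sup>2\<close> by (simp del: mult_Suc_right)
    finally have card_Q: "card Q \<le> 2 * d\<^sup>2 * Suc e" .
    have piece: "cube_degree_le V (2 * (Suc e)\<^sup>2 * d\<^sup>2)
      (\<lambda>A. of_bool (A \<inter> Q = a) * of_bool (F\<^sub>1 (a \<union> (A - Q)) \<noteq> 0))" if a: "a \<subseteq> Q" for a
    proof -
      have fin': "finite (V - Q)" using fin by simp
      have F\<^sub>1': "cube_degree_le (V - Q) e (\<lambda>A. F\<^sub>1 (a \<union> A))"
      proof (rule cube_degree_le_restrict_below_top[OF fin c _ a Q(1)])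
        fix M assume M: "M \<subseteq> V" "card M = Suc e" "c M \<noteq> 0"
        then have "M \<noteq> {}" by auto
        then show "M \<inter> Q \<noteq> {}" using hit[of M] M unfolding \<T>_def Q_def by blast
      qed
      have F\<^sub>2': "cube_degree_le (V - Q) d (\<lambda>A. F\<^sub>2 (a \<union> A))"
      proof (rule cube_degree_le_substitute[OF fin fin' Suc.prems(3)])
        fix i assume "i \<in> V"
        show "cube_degree_le (V - Q) 1 (\<lambda>A. of_bool (i \<in> a \<union> A))"
        proof (cases "i \<in> Q")
          case True
          show ?thesis
            by (rule cube_degree_le_cong[OF cube_degree_le_const[OF fin', of _ "of_bool (i \<in> a)"]])
              (use True in auto)
        next
          case False
          show ?thesis
            by (rule cube_degree_le_cong[OF cube_degree_le_mem[OF fin', of i]])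
              (use False a \<open>i \<in> V\<close> in auto)
        qed
      qed (use a Q in auto)
      have sub: "a \<union> A \<subseteq> V" if "A \<subseteq> V - Q" for A using a Q(1) that by blast
      have "cube_degree_le (V - Q) (2 * e\<^sup>2 * d\<^sup>2) (\<lambda>A. of_bool (F\<^sub>1 (a \<union> A) \<noteq> 0))"
        by (rule Suc.IH[OF fin' F\<^sub>1' F\<^sub>2']) (use Suc.prems(4,5) sub in auto)
      then have "cube_degree_le V (2 * e\<^sup>2 * d\<^sup>2) (\<lambda>A. of_bool (F\<^sub>1 (a \<union> (A - Q)) \<noteq> 0))"
      proof (rule cube_degree_le_substitute[OF fin' fin])
        fix i assume i: "i \<in> V - Q"
        show "cube_degree_le V 1 (\<lambda>A. of_bool (i \<in> A - Q))"
          by (rule cube_degree_le_cong[OF cube_degree_le_mem[OF fin, of i]]) (use i in auto)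
      qed auto
      then have "cube_degree_le V (card Q + 2 * e\<^sup>2 * d\<^sup>2)
        (\<lambda>A. of_bool (A \<inter> Q = a) * of_bool (F\<^sub>1 (a \<union> (A - Q)) \<noteq> 0))"
        by (intro cube_degree_le_mult fin cube_degree_le_inter_eq Q a)
      \<comment> \<open>The cost of fixing \<open>Q\<close> is absorbed because (e+1) + e^2 is at
        most (e+1)^2.\<close>
      moreover have "card Q + 2 * e\<^sup>2 * d\<^sup>2 \<le> 2 * (Suc e)\<^sup>2 * d\<^sup>2"
      proof -
        have "card Q + 2 * e\<^sup>2 * d\<^sup>2 \<le> 2 * (Suc e + e\<^sup>2) * d\<^sup>2"
          using card_Q by (simp add: algebra_simps)
        also have "\<dots> \<le> 2 * (Suc e)\<^sup>2 * d\<^sup>2"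
          by (intro mult_right_mono mult_left_mono) (auto simp: power2_eq_square)
        finally show ?thesis .
      qed
      ultimately show ?thesis by (rule cube_degree_le_mono)
    qed
    \<comment> \<open>For each \<open>A\<close> only the summand with
      \<open>a = A \<inter> Q\<close> survives, and then
      \<open>a \<union> (A - Q) = A\<close>.\<close>
    have "cube_degree_le V (2 * (Suc e)\<^sup>2 * d\<^sup>2)
      (\<lambda>A. \<Sum>a\<in>Pow Q. of_bool (A \<inter> Q = a) * of_bool (F\<^sub>1 (a \<union> (A - Q)) \<noteq> 0))"
      by (rule cube_degree_le_sum[OF fin]) (use piece in auto)
    then show ?thesis
    proof (rule cube_degree_le_cong)
      fix A assume "A \<subseteq> V"
      have "(\<Sum>a\<in>Pow Q. of_bool (A \<inter> Q = a) * of_bool (F\<^sub>1 (a \<union> (A - Q)) \<noteq> 0))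
        = (\<Sum>a\<in>Pow Q. if A \<inter> Q = a then of_bool (F\<^sub>1 (a \<union> (A - Q)) \<noteq> 0) else (0::real))"
        by (intro sum.cong) auto
      also have "\<dots> = of_bool (F\<^sub>1 A \<noteq> 0)"
        using Q(2) by (simp add: Int_Diff_Un)
      finally show "of_bool (F\<^sub>1 A \<noteq> 0)
        = (\<Sum>a\<in>Pow Q. of_bool (A \<inter> Q = a) * of_bool (F\<^sub>1 (a \<union> (A - Q)) \<noteq> 0) :: real)" by simp
    qed
  qed
qed

section \<open>Multivariate polynomials on the cube\<close>

text \<open>The restriction makes the value \<open>undefined\<close> outside \<open>{..<n}\<close>,
  matching the extensional functions that form \<open>cube n\<close>.\<close>

definition cube_point :: "nat \<Rightarrow> nat set \<Rightarrow> nat \<Rightarrow> real" where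
  "cube_point n A = restrict (\<lambda>i. of_bool (i \<in> A)) {..<n}"

lemma cube_eq_image_cube_point: "cube n = cube_point n ` Pow {..<n}"
proof (intro equalityI subsetI)
  fix x assume x: "x \<in> cube n"
  have "x = cube_point n {i \<in> {..<n}. x i = 1}"
  proof
    fix i
    show "x i = cube_point n {i \<in> {..<n}. x i = 1} i"
      using x by (cases "i < n") (auto simp: cube_def cube_point_def PiE_iff extensional_def)
  qed
  then show "x \<in> cube_point n ` Pow {..<n}" by blast
next
  fix x assume "x \<in> cube_point n ` Pow {..<n}"
  then show "x \<in> cube n" by (auto simp: cube_def cube_point_def PiE_iff)
qed

definition squarefree_monomial :: "nat set \<Rightarrow> monomial" where
  "squarefree_monomial S = (\<Sum>i\<in>S. Poly_Mapping.single i 1)"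

lemma lookup_squarefree_monomial:
  "finite S \<Longrightarrow> Poly_Mapping.lookup (squarefree_monomial S) i = of_bool (i \<in> S)"
  by (simp add: squarefree_monomial_def lookup_sum lookup_single when_def)

lemma keys_squarefree_monomial: "finite S \<Longrightarrow> Poly_Mapping.keys (squarefree_monomial S) = S"
  by (auto simp: in_keys_iff lookup_squarefree_monomial)

lemma monomial_degree_squarefree_monomial:
  "finite S \<Longrightarrow> monomial_degree (squarefree_monomial S) = card S"
  by (simp add: monomial_degree_def keys_squarefree_monomial lookup_squarefree_monomial)

lemma card_keys_le_monomial_degree: "card (Poly_Mapping.keys m) \<le> monomial_degree m"
proof -
  have "(\<Sum>i\<in>Poly_Mapping.keys m. 1) \<le> (\<Sum>i\<in>Poly_Mapping.keys m. Poly_Mapping.lookup m i)"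
    by (intro sum_mono) (simp add: in_keys_iff Suc_leI)
  then show ?thesis by (simp add: monomial_degree_def)
qed

lemma monomial_degree_le_mpoly_degree:
  "m \<in> Poly_Mapping.keys p \<Longrightarrow> monomial_degree m \<le> mpoly_degree p"
  unfolding mpoly_degree_def by (intro Max_ge) auto

section \<open>Evaluation as a ring homomorphism\<close>

lemma eval_mpoly_superset:
  assumes "finite K" "Poly_Mapping.keys p \<subseteq> K"
  shows "eval_mpoly x p = (\<Sum>m\<in>K. Poly_Mapping.lookup p m * eval_monomial x m)"
  unfolding eval_mpoly_def
  using assms by (intro sum.mono_neutral_left) (auto simp: in_keys_iff)

lemma eval_mpoly_add: "eval_mpoly x (p + q) = eval_mpoly x p + eval_mpoly x q"
proof -
  let ?K = "Poly_Mapping.keys p \<union> Poly_Mapping.keys q"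
  have "eval_mpoly x r = (\<Sum>m\<in>?K. Poly_Mapping.lookup r m * eval_monomial x m)"
    if "r \<in> {p, q, p + q}" for r
    using that keys_add[of p q] by (intro eval_mpoly_superset) auto
  then show ?thesis by (simp add: lookup_add sum.distrib algebra_simps)
qed

lemma eval_mpoly_sum: "eval_mpoly x (\<Sum>i\<in>I. f i) = (\<Sum>i\<in>I. eval_mpoly x (f i))"
proof -
  have "eval_mpoly x 0 = 0" by (simp add: eval_mpoly_def)
  then show ?thesis
    by (induction I rule: infinite_finite_induct) (auto simp: eval_mpoly_add)
qed

lemma eval_mpoly_single: "eval_mpoly x (Poly_Mapping.single m k) = k * eval_monomial x m"
  using eval_mpoly_superset[of "{m}" "Poly_Mapping.single m k"] by simp

lemma eval_monomial_superset:
  assumes "finite K" "Poly_Mapping.keys m \<subseteq> K"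
  shows "eval_monomial x m = (\<Prod>i\<in>K. x i ^ Poly_Mapping.lookup m i)"
  unfolding eval_monomial_def
  using assms by (intro prod.mono_neutral_left) (auto simp: in_keys_iff)

lemma eval_monomial_add: "eval_monomial x (m + m') = eval_monomial x m * eval_monomial x m'"
proof -
  let ?K = "Poly_Mapping.keys m \<union> Poly_Mapping.keys m'"
  have "eval_monomial x r = (\<Prod>i\<in>?K. x i ^ Poly_Mapping.lookup r i)"
    if "r \<in> {m, m', m + m'}" for r
    using that keys_add[of m m'] by (intro eval_monomial_superset) auto
  then show ?thesis by (simp add: lookup_add power_add prod.distrib)
qed

lemma mpoly_eq_sum_single:
  "(p :: real_mpoly) = (\<Sum>m\<in>Poly_Mapping.keys p. Poly_Mapping.single m (Poly_Mapping.lookup p m))"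
  by (rule poly_mapping_eqI) (auto simp: lookup_sum lookup_single when_def in_keys_iff)

lemma eval_mpoly_mult: "eval_mpoly x (p * q) = eval_mpoly x p * eval_mpoly x q"
proof -
  have "p * q = (\<Sum>m\<in>Poly_Mapping.keys p. \<Sum>m'\<in>Poly_Mapping.keys q.
      Poly_Mapping.single (m + m') (Poly_Mapping.lookup p m * Poly_Mapping.lookup q m'))"
    using arg_cong2[of _ _ _ _ "(*)", OF mpoly_eq_sum_single[of p] mpoly_eq_sum_single[of q]]
    unfolding sum_product mult_single .
  then show ?thesis
    by (simp add: eval_mpoly_sum eval_mpoly_single eval_monomial_add)
      (simp add: eval_mpoly_def sum_product algebra_simps)
qed

lemma mpolys_mult:
  assumes "p \<in> mpolys n" "q \<in> mpolys n"
  shows "p * q \<in> mpolys n"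
  unfolding mpolys_def
proof (intro CollectI ballI)
  fix m assume "m \<in> Poly_Mapping.keys (p * q)"
  then obtain a b where "m = a + b" "a \<in> Poly_Mapping.keys p" "b \<in> Poly_Mapping.keys q"
    using keys_mult[of p q] by blast
  then show "Poly_Mapping.keys m \<subseteq> {..<n}"
    using keys_add[of a b] assms unfolding mpolys_def by blast
qed

section \<open>Multilinearization and restriction to the cube\<close>

lemma eval_monomial_cube_point:
  assumes "Poly_Mapping.keys m \<subseteq> {..<n}"
  shows "eval_monomial (cube_point n A) m = of_bool (Poly_Mapping.keys m \<subseteq> A)"
proof -
  have "eval_monomial (cube_point n A) m = (\<Prod>i\<in>Poly_Mapping.keys m. of_bool (i \<in> A))"
    unfolding eval_monomial_def
  proof (intro prod.cong refl)
    fix i assume i: "i \<in> Poly_Mapping.keys m"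
    then have "i < n" using assms by blast
    \<comment> \<open>A positive power of 0 or 1 is that number itself; exponent 0 would give 1 even
      at 0.\<close>
    moreover have "Poly_Mapping.lookup m i \<noteq> 0" using i by (simp add: in_keys_iff)
    ultimately show "cube_point n A i ^ Poly_Mapping.lookup m i = of_bool (i \<in> A)"
      by (simp add: cube_point_def)
  qed
  then show ?thesis by (simp add: prod_of_bool subset_eq)
qed

text \<open>For finite \<open>S\<close> this is the coefficient of
  \<open>squarefree_monomial S\<close> in \<open>multilinearization p\<close>, where monomials with
  equal support are merged.\<close>

definition multilinear_coeff :: "real_mpoly \<Rightarrow> nat set \<Rightarrow> real" where
  "multilinear_coeff p S =
     (\<Sum>m\<in>{m \<in> Poly_Mapping.keys p. Poly_Mapping.keys m = S}. Poly_Mapping.lookup p m)"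

lemma eval_mpoly_cube_point:
  assumes "p \<in> mpolys n" "A \<subseteq> {..<n}"
  shows "eval_mpoly (cube_point n A) p = (\<Sum>S\<in>Pow A. multilinear_coeff p S)"
proof -
  let ?K = "{m \<in> Poly_Mapping.keys p. Poly_Mapping.keys m \<subseteq> A}"
  have "eval_mpoly (cube_point n A) p
      = (\<Sum>m\<in>Poly_Mapping.keys p. Poly_Mapping.lookup p m * of_bool (Poly_Mapping.keys m \<subseteq> A))"
    using assms(1) unfolding eval_mpoly_def mpolys_def
    by (intro sum.cong refl) (auto simp: eval_monomial_cube_point)
  also have "\<dots> = (\<Sum>m\<in>?K. Poly_Mapping.lookup p m)"
    by (intro sum.mono_neutral_cong_right) auto
  also have "\<dots> = (\<Sum>S\<in>Pow A. \<Sum>m\<in>{m \<in> ?K. Poly_Mapping.keys m = S}. Poly_Mapping.lookup p m)"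
    using assms(2) finite_subset[OF assms(2)] by (intro sum.group[symmetric]) auto
  also have "\<dots> = (\<Sum>S\<in>Pow A. multilinear_coeff p S)"
    unfolding multilinear_coeff_def by (intro sum.cong refl) auto
  finally show ?thesis .
qed

lemma cube_degree_le_eval_mpoly:
  assumes "p \<in> mpolys n"
  shows "cube_degree_le {..<n} (mpoly_degree p) (\<lambda>A. eval_mpoly (cube_point n A) p)"
  unfolding cube_degree_le_def
proof (intro exI[of _ "multilinear_coeff p"] conjI allI impI)
  fix S :: "nat set" assume S: "mpoly_degree p < card S"
  have "Poly_Mapping.keys m \<noteq> S" if "m \<in> Poly_Mapping.keys p" for m
    using card_keys_le_monomial_degree[of m] monomial_degree_le_mpoly_degree[OF that] S by auto
  then have "{m \<in> Poly_Mapping.keys p. Poly_Mapping.keys m = S} = {}" by blast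
  then show "multilinear_coeff p S = 0" unfolding multilinear_coeff_def by (simp only: sum.empty)
qed (use eval_mpoly_cube_point[OF assms] in auto)

text \<open>Multilinear coefficients are determined by the values on the cube, so those of
  \<open>p\<close> agree with the coefficients \<open>c\<close> witnessing the degree bound. A
  monomial surviving in the multilinearization thus has a support of size at most
  \<open>d\<close>.\<close>

lemma mpoly_degree_multilinearization_le:
  assumes p: "p \<in> mpolys n"
    and deg: "cube_degree_le {..<n} d (\<lambda>A. eval_mpoly (cube_point n A) p)"
  shows "mpoly_degree (multilinearization p) \<le> d"
proof -
  obtain c where c: "\<And>A. A \<subseteq> {..<n} \<Longrightarrow> eval_mpoly (cube_point n A) p = (\<Sum>S\<in>Pow A. c S)"
    "\<And>S. S \<subseteq> {..<n} \<Longrightarrow> d < card S \<Longrightarrow> c S = 0"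
    using deg unfolding cube_degree_le_def by blast
  have coeff: "multilinear_coeff p S = c S" if "S \<subseteq> {..<n}" for S
  proof (rule cube_coeff_unique[OF finite_lessThan _ that])
    fix A assume "A \<subseteq> {..<n}"
    then show "(\<Sum>S\<in>Pow A. multilinear_coeff p S) = (\<Sum>S\<in>Pow A. c S)"
      using c(1) eval_mpoly_cube_point[OF p] by metis
  qed
  have "monomial_degree k \<le> d" if k: "k \<in> Poly_Mapping.keys (multilinearization p)" for k
  proof -
    have ml: "multilinearization p = (\<Sum>m\<in>Poly_Mapping.keys p.
        Poly_Mapping.single (squarefree_monomial (Poly_Mapping.keys m)) (Poly_Mapping.lookup p m))"
      by (simp add: multilinearization_def multilinear_monomial_def squarefree_monomial_def)
    obtain m where m: "m \<in> Poly_Mapping.keys p" and "k \<in> Poly_Mapping.keys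
        (Poly_Mapping.single (squarefree_monomial (Poly_Mapping.keys m)) (Poly_Mapping.lookup p m))"
      using subsetD[OF keys_sum k[unfolded ml]] by blast
    then have k_eq: "k = squarefree_monomial (Poly_Mapping.keys m)" by (simp split: if_splits)
    let ?S = "Poly_Mapping.keys m"
    \<comment> \<open>A squarefree monomial determines its support, so exactly the monomials with
      support \<open>?S\<close> contribute to the coefficient of \<open>k\<close>.\<close>
    have eq: "squarefree_monomial (Poly_Mapping.keys m') = k \<longleftrightarrow> Poly_Mapping.keys m' = ?S" for m'
      unfolding k_eq by (metis keys_squarefree_monomial finite_keys)
    have "Poly_Mapping.lookup (multilinearization p) k = multilinear_coeff p ?S"
      unfolding ml multilinear_coeff_def
      by (simp add: lookup_sum lookup_single when_def eq sum.inter_filter)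
    moreover have S: "?S \<subseteq> {..<n}" using p m unfolding mpolys_def by blast
    ultimately have "c ?S \<noteq> 0" using k coeff by (simp add: in_keys_iff)
    then have "card ?S \<le> d" using c(2)[OF S] by (meson not_le)
    then show ?thesis using k_eq by (simp add: monomial_degree_squarefree_monomial)
  qed
  then show ?thesis unfolding mpoly_degree_def by auto
qed

text \<open>The polynomial is read off from the multilinear expansion of \<open>F\<close>. Its
  degree is left uncontrolled, since the final bound concerns only the products with the given
  polynomials.\<close>

lemma mpoly_interpolation:
  obtains p where "p \<in> mpolys n"
    "\<And>A. A \<subseteq> {..<n} \<Longrightarrow> eval_mpoly (cube_point n A) p = F A"
proof -
  obtain c where c: "\<And>A. A \<subseteq> {..<n} \<Longrightarrow> F A = (\<Sum>S\<in>Pow {..<n}. c S * of_bool (S \<subseteq> A))"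
    using cube_degree_le_expand[OF finite_lessThan cube_degree_le_card[OF finite_lessThan], of n F]
    by blast
  define p where "p = (\<Sum>S\<in>Pow {..<n}. Poly_Mapping.single (squarefree_monomial S) (c S))"
  have keys: "Poly_Mapping.keys (squarefree_monomial S) = S" if "S \<in> Pow {..<n}" for S
    using that finite_subset[of S "{..<n}"] by (intro keys_squarefree_monomial) auto
  show ?thesis
  proof (rule that[of p])
    show "p \<in> mpolys n"
      unfolding mpolys_def
    proof (intro CollectI ballI)
      fix m assume m: "m \<in> Poly_Mapping.keys p"
      obtain S where "S \<in> Pow {..<n}"
        "m \<in> Poly_Mapping.keys (Poly_Mapping.single (squarefree_monomial S) (c S))"
        using subsetD[OF keys_sum m[unfolded p_def]] by blast
      then show "Poly_Mapping.keys m \<subseteq> {..<n}" using keys by (auto split: if_splits)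
    qed
  next
    fix A assume A: "A \<subseteq> {..<n}"
    show "eval_mpoly (cube_point n A) p = F A"
      unfolding p_def c[OF A] eval_mpoly_sum eval_mpoly_single
      using keys by (intro sum.cong refl) (simp add: eval_monomial_cube_point)
  qed
qed

theorem theorem4p1:
  fixes n :: nat and g\<^sub>1 g\<^sub>2 :: real_mpoly
  assumes "g\<^sub>1 \<in> mpolys n" and "g\<^sub>2 \<in> mpolys n"
    and "\<not> (\<exists>x \<in> cube n. eval_mpoly x g\<^sub>1 = 0 \<and> eval_mpoly x g\<^sub>2 = 0)"
    and "\<forall>x \<in> cube n. eval_mpoly x g\<^sub>1 * eval_mpoly x g\<^sub>2 = 0"
  shows "\<exists>h\<^sub>1 \<in> mpolys n. \<exists>h\<^sub>2 \<in> mpolys n.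
    (\<forall>x \<in> cube n. eval_mpoly x h\<^sub>1 * eval_mpoly x g\<^sub>1 + eval_mpoly x h\<^sub>2 * eval_mpoly x g\<^sub>2 = 1) \<and>
    max (mpoly_degree (multilinearization (h\<^sub>1 * g\<^sub>1)))
        (mpoly_degree (multilinearization (h\<^sub>2 * g\<^sub>2)))
      \<le> 2 * (mpoly_degree g\<^sub>1)\<^sup>2 * (mpoly_degree g\<^sub>2)\<^sup>2"
proof -
  let ?F\<^sub>1 = "\<lambda>A. eval_mpoly (cube_point n A) g\<^sub>1" and ?F\<^sub>2 = "\<lambda>A. eval_mpoly (cube_point n A) g\<^sub>2"
  let ?D = "2 * (mpoly_degree g\<^sub>1)\<^sup>2 * (mpoly_degree g\<^sub>2)\<^sup>2"
  have prod: "?F\<^sub>1 A * ?F\<^sub>2 A = 0" and disj: "\<not> (?F\<^sub>1 A = 0 \<and> ?F\<^sub>2 A = 0)" if "A \<subseteq> {..<n}" for A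
    using assms(3,4) that unfolding cube_eq_image_cube_point by auto
  have deg\<^sub>1: "cube_degree_le {..<n} ?D (\<lambda>A. of_bool (?F\<^sub>1 A \<noteq> 0))"
    by (rule cube_degree_le_support[OF finite_lessThan cube_degree_le_eval_mpoly[OF assms(1)]
          cube_degree_le_eval_mpoly[OF assms(2)] prod disj])
  \<comment> \<open>At each point of the cube exactly one of the two polynomials vanishes, so this
    complement is the indicator of the support of \<open>g\<^sub>2\<close> and obeys the same
    bound.\<close>
  have deg\<^sub>2: "cube_degree_le {..<n} ?D (\<lambda>A. 1 - of_bool (?F\<^sub>1 A \<noteq> 0))"
    by (rule cube_degree_le_diff[OF cube_degree_le_const deg\<^sub>1]) simp
  (* inverse 0 = 0, so h * g is the indicator of the support of g *)
  obtain h\<^sub>1 where h\<^sub>1: "h\<^sub>1 \<in> mpolys n"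
    "\<And>A. A \<subseteq> {..<n} \<Longrightarrow> eval_mpoly (cube_point n A) h\<^sub>1 = inverse (?F\<^sub>1 A)"
    using mpoly_interpolation[of n "\<lambda>A. inverse (?F\<^sub>1 A)"] by blast
  obtain h\<^sub>2 where h\<^sub>2: "h\<^sub>2 \<in> mpolys n"
    "\<And>A. A \<subseteq> {..<n} \<Longrightarrow> eval_mpoly (cube_point n A) h\<^sub>2 = inverse (?F\<^sub>2 A)"
    using mpoly_interpolation[of n "\<lambda>A. inverse (?F\<^sub>2 A)"] by blast
  have eval\<^sub>1: "eval_mpoly (cube_point n A) (h\<^sub>1 * g\<^sub>1) = of_bool (?F\<^sub>1 A \<noteq> 0)"
    and eval\<^sub>2: "eval_mpoly (cube_point n A) (h\<^sub>2 * g\<^sub>2) = 1 - of_bool (?F\<^sub>1 A \<noteq> 0)"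
    if "A \<subseteq> {..<n}" for A
    using h\<^sub>1(2)[OF that] h\<^sub>2(2)[OF that] prod[OF that] disj[OF that] by (auto simp: eval_mpoly_mult)
  have "mpoly_degree (multilinearization (h\<^sub>1 * g\<^sub>1)) \<le> ?D"
    using mpolys_mult[OF h\<^sub>1(1) assms(1)] cube_degree_le_cong[OF deg\<^sub>1 eval\<^sub>1]
    by (rule mpoly_degree_multilinearization_le)
  moreover have "mpoly_degree (multilinearization (h\<^sub>2 * g\<^sub>2)) \<le> ?D"
    using mpolys_mult[OF h\<^sub>2(1) assms(2)] cube_degree_le_cong[OF deg\<^sub>2 eval\<^sub>2]
    by (rule mpoly_degree_multilinearization_le)
  moreover have "eval_mpoly x h\<^sub>1 * eval_mpoly x g\<^sub>1 + eval_mpoly x h\<^sub>2 * eval_mpoly x g\<^sub>2 = 1"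
    if x: "x \<in> cube n" for x
  proof -
    obtain A where A: "A \<subseteq> {..<n}" "x = cube_point n A"
      using x unfolding cube_eq_image_cube_point by auto
    show ?thesis using eval\<^sub>1[OF A(1)] eval\<^sub>2[OF A(1)] by (simp add: A(2) eval_mpoly_mult)
  qed
  ultimately show ?thesis using h\<^sub>1(1) h\<^sub>2(1) by (intro bexI[of _ h\<^sub>1] bexI[of _ h\<^sub>2]) auto
qed

end
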